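(* Let $m\ge1$ and let $L_i(z)=\sum_{j=1}^m a_{ij}z_j+b_i=\mathbf{a}_i\cdot z+b_i$, $i=1,\dotsc,d$, be affine functions on $\mathbb{C}^m$ with $|\mathbf{a}_i|=1$, whose zero sets $W_i=\{L_i=0\}$ form a generic hyperplane arrangement (in particular the $W_i$ are distinct and $W_i\cap W_j\ne\emptyset$ for all $i,j$). Let $P=L_1\cdots L_d$, $$\Psi(z)=\max_{i=1,\dotsc,d}\log|L_i(z)|^{-1}+\log|P(z)|\;\Big(=\max_i\sum_{j\ne i}\log|L_j(z)|\Big),$$ $E=dd^c\Psi$, and $E_n=dd^c\log\big|P^n(L_1^{-n}+\dots+L_d^{-n})\big|$, where $P^n(L_1^{-n}+\dots+L_d^{-n})=\sum_{i}\prod_{j\ne i}L_j^n$ is a polynomial. Then $\frac1nE_n\to E$ as currents (weakly, i.e. when paired with any smooth compactly supported test form of bidegree $(m-1,m-1)$).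
   Context: $|\mathbf{a}_i|$ is the Hermitian norm of $\mathbf{a}_i=(a_{i1},\dotsc,a_{im})\in\mathbb{C}^m$ (so $|L_i(z)|$ is the distance from $z$ to $W_i$). $d^c$ is the standard real operator with $dd^c=\frac{i}{\pi}\partial\bar\partial$, and $dd^c$ of a plurisubharmonic (or locally integrable) function is taken in the sense of currents; $E_n$ is, up to normalization, the current of integration over the hypersurface $\{\sum_i\prod_{j\neq i}L_j^n=0\}$ with multiplicities, and $E$ is supported on the codimension-one skeleton of the Voronoi stratification $\{z:|L_i(z)|=\min_k|L_k(z)|\}$. *)

theory Defs
  imports "HOL-Analysis.Analysis"
begin

text \<open>Points of C^m are modelled as vectors of type complex^'m ('m a finite index type,
  so m = CARD('m) >= 1).  Test functions are complex-valued functions on C^m.\<close>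

definition dir_deriv :: "(complex^'m \<Rightarrow> complex) \<Rightarrow> complex^'m \<Rightarrow> complex^'m \<Rightarrow> complex" where
  "dir_deriv f v x = frechet_derivative f (at x) v"

coinductive smooth_fun :: "(complex^'m \<Rightarrow> complex) \<Rightarrow> bool" where
  "(\<forall>x. f differentiable (at x)) \<Longrightarrow> (\<forall>v. smooth_fun (\<lambda>x. dir_deriv f v x)) \<Longrightarrow> smooth_fun f"

definition test_fun :: "(complex^'m \<Rightarrow> complex) \<Rightarrow> bool" where
  "test_fun f \<longleftrightarrow> smooth_fun f \<and> compact (closure {x. f x \<noteq> 0})"

definition wirt_dz :: "(complex^'m \<Rightarrow> complex) \<Rightarrow> 'm \<Rightarrow> complex^'m \<Rightarrow> complex" where
  "wirt_dz f j x = (dir_deriv f (axis j 1) x - \<i> * dir_deriv f (axis j \<i>) x) / 2"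

definition wirt_dzbar :: "(complex^'m \<Rightarrow> complex) \<Rightarrow> 'm \<Rightarrow> complex^'m \<Rightarrow> complex" where
  "wirt_dzbar f j x = (dir_deriv f (axis j 1) x + \<i> * dir_deriv f (axis j \<i>) x) / 2"

text \<open>Weak convergence of the (1,1)-currents dd^c u_n to dd^c u, for locally integrable u_n, u:
  for every test form phi of bidegree (m-1,m-1), <dd^c u_n, phi> = <u_n, dd^c phi> converges.
  dd^c phi is a linear combination of the terms d^2 phi_{jk}/dz_j dzbar_k (times the volume form)
  of the coefficient functions phi_{jk} of phi, and each coefficient can be an arbitrary test
  function independently; so the convergence unfolds to the following.\<close>
definition ddc_converges ::
  "(nat \<Rightarrow> complex^'m \<Rightarrow> real) \<Rightarrow> (complex^'m \<Rightarrow> real) \<Rightarrow> bool" where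
  "ddc_converges u U \<longleftrightarrow>
     (\<forall>g j k. test_fun g \<longrightarrow>
        (\<lambda>n. integral\<^sup>L lborel (\<lambda>x. complex_of_real (u n x) * wirt_dz (wirt_dzbar g k) j x))
        \<longlonglongrightarrow> integral\<^sup>L lborel (\<lambda>x. complex_of_real (U x) * wirt_dz (wirt_dzbar g k) j x))"

definition aff :: "complex^'m \<Rightarrow> complex \<Rightarrow> complex^'m \<Rightarrow> complex" where
  "aff a b z = (\<Sum>j\<in>UNIV. a $ j * z $ j) + b"

text \<open>Generic (general position) hyperplane arrangement W_i = {L_i = 0}, i < d, in C^m:
  the hyperplanes are distinct, the normals of any at most m of them are C-linearly independent
  (so any k <= m of them meet in codimension k), and any more than m of them have empty
  intersection.\<close>
definition generic_arrangement :: "nat \<Rightarrow> (nat \<Rightarrow> complex^'m) \<Rightarrow> (nat \<Rightarrow> complex) \<Rightarrow> bool" where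
  "generic_arrangement d a b \<longleftrightarrow>
     (\<forall>i<d. \<forall>j<d. i \<noteq> j \<longrightarrow> {z. aff (a i) (b i) z = 0} \<noteq> {z. aff (a j) (b j) z = 0}) \<and>
     (\<forall>I. I \<subseteq> {..<d} \<longrightarrow> card I \<le> CARD('m) \<longrightarrow>
         inj_on a I \<and> (\<forall>c :: nat \<Rightarrow> complex. (\<Sum>i\<in>I. c i *s a i) = 0 \<longrightarrow> (\<forall>i\<in>I. c i = 0))) \<and>
     (\<forall>I. I \<subseteq> {..<d} \<longrightarrow> card I > CARD('m) \<longrightarrow>
         (\<Inter>i\<in>I. {z. aff (a i) (b i) z = 0}) = {})"

end

theory Submission
  imports Defs "HOL-Computational_Algebra.Fundamental_Theorem_Algebra"
begin

text \<open>
  Write \<open>Q\<^sub>n = \<Sum>\<^sub>i \<Prod>\<^sub>j\<^sub>\<noteq>\<^sub>i L\<^sub>j\<^sup>n\<close> and \<open>u\<^sub>n = log |Q\<^sub>n| / n\<close>. Off the Lebesgue null set where two of the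
  \<open>|L\<^sub>i|\<close> agree or some \<open>L\<^sub>i\<close> vanishes, one summand of \<open>Q\<^sub>n\<close> dominates, so \<open>u\<^sub>n \<rightarrow> \<Psi>\<close> almost everywhere.
  It remains to see that the \<open>u\<^sub>n\<close> are bounded in \<open>L\<^sup>2\<close> on compact sets, as this gives uniform
  integrability. The upper bound on \<open>u\<^sub>n\<close> is trivial. For the lower bound choose a direction \<open>v\<close> for
  which the numbers \<open>|a\<^sub>i \<cdot> v|\<close> are nonzero and pairwise distinct. On each real line \<open>z + t v\<close> the
  function \<open>Q\<^sub>n\<close> is a polynomial in \<open>t\<close> of degree \<open>(d - 1) n\<close> whose leading coefficient
  \<open>\<Sum>\<^sub>i \<Prod>\<^sub>j\<^sub>\<noteq>\<^sub>i (a\<^sub>j \<cdot> v)\<^sup>n\<close> does not depend on \<open>z\<close> and grows exactly exponentially. Factoring it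
  over its roots bounds the negative part of \<open>u\<^sub>n\<close> by a constant plus an average of translates of
  the negative part of \<open>log |t|\<close>, which is square integrable. Tonelli and translation invariance turn
  this bound on lines into a bound on compact sets.
\<close>

section \<open>Integration along parallel real lines\<close>

lemma nn_integral_lborel_translate:
  fixes f :: "'a::euclidean_space \<Rightarrow> ennreal"
  assumes [measurable]: "f \<in> borel_measurable borel"
  shows "(\<integral>\<^sup>+z. f (z + c) \<partial>lborel) = (\<integral>\<^sup>+z. f z \<partial>lborel)"
proof -
  have "(\<integral>\<^sup>+z. f z \<partial>lborel) = (\<integral>\<^sup>+z. f z \<partial>distr lborel borel ((+) c))"
    by (simp add: lborel_distr_plus)
  also have "\<dots> = (\<integral>\<^sup>+z. f (z + c) \<partial>lborel)"
    by (subst nn_integral_distr) (auto simp: add.commute)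
  finally show ?thesis by simp
qed

text \<open>By Tonelli the integrals may be swapped, and for each fixed \<open>t\<close> the
  integral over \<open>z\<close> is unchanged by the shift \<open>t *\<^sub>R v\<close>; the range
  of \<open>t\<close> has length 1. Bounds on segments in direction \<open>v\<close> thus become
  bounds on integrals over the whole space.\<close>

lemma nn_integral_lborel_average_line:
  fixes f :: "'a::euclidean_space \<Rightarrow> ennreal" and v :: 'a
  assumes [measurable]: "f \<in> borel_measurable borel"
  shows "(\<integral>\<^sup>+z. f z \<partial>lborel) =
    (\<integral>\<^sup>+z. (\<integral>\<^sup>+t. f (z + t *\<^sub>R v) * indicator {0..1} t \<partial>lborel) \<partial>lborel)"
proof -
  have "(\<integral>\<^sup>+z. (\<integral>\<^sup>+t. f (z + t *\<^sub>R v) * indicator {0..1::real} t \<partial>lborel) \<partial>lborel)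
      = (\<integral>\<^sup>+t. (\<integral>\<^sup>+z. f (z + t *\<^sub>R v) * indicator {0..1::real} t \<partial>lborel) \<partial>lborel)"
    by (rule lborel_pair.Fubini'[symmetric]) measurable
  also have "\<dots> = (\<integral>\<^sup>+t. (\<integral>\<^sup>+z. f z \<partial>lborel) * indicator {0..1::real} t \<partial>lborel)"
    by (simp add: nn_integral_multc nn_integral_lborel_translate)
  also have "\<dots> = (\<integral>\<^sup>+z. f z \<partial>lborel)"
    by (simp add: nn_integral_cmult)
  finally show ?thesis by simp
qed

text \<open>When the indicator of \<open>S\<close> is averaged over segments in direction
  \<open>v\<close>, every inner integral is that of a function vanishing off a finite set.\<close>

lemma null_sets_lborel_lines:
  fixes S :: "'a::euclidean_space set" and v :: 'a
  assumes S: "S \<in> sets borel" and fin: "\<And>z. finite {t::real. z + t *\<^sub>R v \<in> S}"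
  shows "S \<in> null_sets lborel"
proof -
  have "(\<integral>\<^sup>+t. indicator S (z + t *\<^sub>R v) * indicator {0..1} t \<partial>lborel) = 0" for z
  proof -
    have "AE t in lborel. t \<notin> {t. z + t *\<^sub>R v \<in> S}"
      by (intro AE_not_in finite_imp_null_set_lborel fin)
    then have "(\<integral>\<^sup>+t. indicator S (z + t *\<^sub>R v) * indicator {0..1} t \<partial>lborel)
        = (\<integral>\<^sup>+t. 0 \<partial>(lborel :: real measure))"
      by (intro nn_integral_cong_AE) (auto elim!: eventually_mono)
    then show ?thesis by simp
  qed
  moreover have "emeasure lborel S = (\<integral>\<^sup>+z. indicator S z \<partial>lborel)"
    using S by simp
  ultimately show ?thesis
    using S nn_integral_lborel_average_line[of "indicator S" v] by (auto simp: null_sets_def)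
qed

section \<open>Square integrability of logarithms of polynomials on a line\<close>

text \<open>The logarithmic pole is weaker than any power:
  \<open>- ln s = 4 * ln (s powr (-1/4)) \<le> 4 * s powr (-1/4)\<close> for
  \<open>0 < s \<le> 1\<close>, and the square \<open>16 * s powr (-1/2)\<close> is integrable at 0.
  Translation invariance makes the constant independent of \<open>\<rho>\<close>, so that all roots
  of a polynomial can be treated alike.\<close>

lemma square_integrable_negative_log:
  obtains C where "C \<ge> 0"
    "\<And>\<rho>. (\<integral>\<^sup>+t. ennreal ((max 0 (- ln \<bar>t - \<rho>\<bar>))\<^sup>2) \<partial>lborel) \<le> ennreal C"
proof -
  define h where "h t = ennreal ((max 0 (- ln \<bar>t\<bar>))\<^sup>2)" for t :: real
  define g where "g t = ennreal (16 * t powr (-1/2)) * indicator {0..1} t" for t :: real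
  have [measurable]: "h \<in> borel_measurable borel" "g \<in> borel_measurable borel"
    unfolding h_def g_def by measurable
  have hg: "h t \<le> g t + g (-t)" for t
  proof -
    have pos: "h s \<le> g s" if "0 < s" "s \<le> 1" for s
    proof -
      have "- ln s = 4 * ln (s powr (-1/4))"
        using that by (simp add: ln_powr)
      also have "\<dots> \<le> 4 * s powr (-1/4)"
        using that by (intro mult_left_mono ln_bound) auto
      finally have "(max 0 (- ln \<bar>s\<bar>))\<^sup>2 \<le> (4 * s powr (-1/4))\<^sup>2"
        using that by (intro power_mono) auto
      also have "\<dots> = 16 * s powr (-1/2)"
        by (simp add: power_mult_distrib power2_eq_square flip: powr_add)
      finally show ?thesis
        using that by (simp add: h_def g_def)
    qed
    \<comment> \<open>The point 0 is a case of its own: \<open>ln 0 = 0\<close> makes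
      \<open>h 0\<close> vanish. For \<open>\<bar>t\<bar> > 1\<close> the maximum in
      \<open>h\<close> is 0.\<close>
    consider "\<bar>t\<bar> > 1" | "t = 0" | "0 < t" "t \<le> 1" | "0 < -t" "-t \<le> 1"
      by linarith
    then show ?thesis
    proof cases
      case 3 then show ?thesis using pos[of t] by (simp add: add_increasing2)
    next
      case 4 then show ?thesis using pos[of "-t"] by (simp add: h_def add_increasing)
    qed (auto simp: h_def)
  qed
  have "((\<lambda>x::real. x powr (-1/2)) has_integral (1 powr (-1/2+1) / (-1/2+1))) {0..1}"
    by (rule has_integral_powr_from_0) auto
  then have "((\<lambda>x::real. 16 * x powr (-1/2)) has_integral 32) {0..1}"
    by (auto dest: has_integral_mult_right[where c=16])
  then have g1: "(\<integral>\<^sup>+t. g t \<partial>lborel) = 32"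
    unfolding g_def by (subst nn_integral_has_integral_lebesgue') auto
  have g2: "(\<integral>\<^sup>+t. g (-t) \<partial>lborel) = 32"
    using nn_integral_real_affine[of g "-1" 0] g1 by simp
  have "(\<integral>\<^sup>+t. h t \<partial>lborel) \<le> (\<integral>\<^sup>+t. g t + g (-t) \<partial>lborel)"
    by (intro nn_integral_mono hg)
  also have "\<dots> = 64"
    by (simp add: nn_integral_add g1 g2)
  finally have "(\<integral>\<^sup>+t. h t \<partial>lborel) \<le> ennreal 64" by simp
  then have "(\<integral>\<^sup>+t. h (t - \<rho>) \<partial>lborel) \<le> ennreal 64" for \<rho>
    using nn_integral_lborel_translate[of h "-\<rho>"] by simp
  then show thesis
    by (intro that[of 64]) (auto simp: h_def)
qed

text \<open>The points \<open>\<rho> k\<close> are excluded because \<open>ln 0 = 0\<close> would make the bound fail there.\<close>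
lemma poly_ln_lower_bound:
  fixes p :: "complex poly"
  assumes "p \<noteq> 0"
  obtains \<rho> :: "nat \<Rightarrow> real" where
    "\<And>t. t \<notin> \<rho> ` {..<degree p} \<Longrightarrow> - ln (cmod (poly p (of_real t))) \<le>
       - ln (cmod (lead_coeff p)) + (\<Sum>k<degree p. max 0 (- ln \<bar>t - \<rho> k\<bar>))"
proof -
  obtain r where r: "smult (lead_coeff p) (\<Prod>i<degree p. [:- r i, 1:]) = p"
    using complex_poly_decompose' by blast
  show thesis
  \<comment> \<open>Moving a root to its real part can only bring it closer to the real point
    \<open>t\<close>, so each \<open>- ln\<close> can only grow; truncation at 0 raises the bound
    further.\<close>
  proof (rule that[of "\<lambda>k. Re (r k)"])
    fix t assume t: "t \<notin> (\<lambda>k. Re (r k)) ` {..<degree p}"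
    have ge: "\<bar>t - Re (r k)\<bar> \<le> cmod (of_real t - r k)" for k
      using abs_Re_le_cmod[of "of_real t - r k"] by simp
    have pos: "0 < \<bar>t - Re (r k)\<bar>" if "k < degree p" for k
      using t that by auto
    have "poly p (of_real t) = lead_coeff p * (\<Prod>i<degree p. of_real t - r i)"
      by (subst r[symmetric]) (simp add: poly_prod del: r)
    then have "ln (cmod (poly p (of_real t)))
        = ln (cmod (lead_coeff p) * (\<Prod>i<degree p. cmod (of_real t - r i)))"
      by (simp add: norm_mult prod_norm)
    also have "\<dots> = ln (cmod (lead_coeff p)) + (\<Sum>i<degree p. ln (cmod (of_real t - r i)))"
    proof (subst ln_mult_pos)
      have "0 < cmod (of_real t - r i)" if "i < degree p" for i
        using pos[OF that] ge[of i] by linarith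
      then show "0 < (\<Prod>i<degree p. cmod (of_real t - r i))"
        "ln (cmod (lead_coeff p)) + ln (\<Prod>i<degree p. cmod (of_real t - r i)) =
          ln (cmod (lead_coeff p)) + (\<Sum>i<degree p. ln (cmod (of_real t - r i)))"
        by (auto intro!: prod_pos ln_prod)
    qed (use assms in auto)
    moreover have "(\<Sum>i<degree p. - ln (cmod (of_real t - r i)))
        \<le> (\<Sum>k<degree p. max 0 (- ln \<bar>t - Re (r k)\<bar>))"
    proof (intro sum_mono)
      fix k assume "k \<in> {..<degree p}"
      then have "ln \<bar>t - Re (r k)\<bar> \<le> ln (cmod (of_real t - r k))"
        using pos[of k] ge[of k] by (subst ln_le_cancel_iff) auto
      then show "- ln (cmod (of_real t - r k)) \<le> max 0 (- ln \<bar>t - Re (r k)\<bar>)" by linarith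
    qed
    ultimately show "- ln (cmod (poly p (of_real t))) \<le>
       - ln (cmod (lead_coeff p)) + (\<Sum>k<degree p. max 0 (- ln \<bar>t - Re (r k)\<bar>))"
      by (simp add: sum_negf)
  qed
qed

text \<open>The roots contribute at most \<open>D * n\<close> terms, each with a uniformly bounded
  square integral, and division by \<open>n\<close> absorbs their number. The bound therefore
  involves only \<open>D\<close> and \<open>A\<close>. The set \<open>S\<close> stands for the part
  of a segment that lies in a given compact set.\<close>

lemma poly_ln_square_integral_bound:
  obtains \<Lambda> :: real where "\<Lambda> \<ge> 0"
    "\<And>(p :: complex poly) n D A S. p \<noteq> 0 \<Longrightarrow> n > 0 \<Longrightarrow> degree p \<le> D * n \<Longrightarrow> A \<ge> 0 \<Longrightarrow>
       - ln (cmod (lead_coeff p)) / real n \<le> A \<Longrightarrow> S \<subseteq> {0..1} \<Longrightarrow>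
       (\<And>t. t \<in> S \<Longrightarrow> ln (cmod (poly p (of_real t))) / real n \<le> A) \<Longrightarrow>
       (\<integral>\<^sup>+t. ennreal ((ln (cmod (poly p (of_real t))) / real n)\<^sup>2) * indicator S t \<partial>lborel)
         \<le> ennreal (2 * A\<^sup>2 + 2 * (real D)\<^sup>2 * \<Lambda>)"
proof -
  obtain \<Lambda> where \<Lambda>: "\<Lambda> \<ge> 0"
    "\<And>\<rho>. (\<integral>\<^sup>+t. ennreal ((max 0 (- ln \<bar>t - \<rho>\<bar>))\<^sup>2) \<partial>lborel) \<le> ennreal \<Lambda>"
    using square_integrable_negative_log by blast
  show thesis
  proof (rule that[OF \<Lambda>(1)])
    fix p :: "complex poly" and n D :: nat and A :: real and S :: "real set"
    assume p: "p \<noteq> 0" and n: "n > 0" and deg: "degree p \<le> D * n" and A: "A \<ge> 0"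
      and lc: "- ln (cmod (lead_coeff p)) / real n \<le> A" and S: "S \<subseteq> {0..1}"
      and up: "\<And>t. t \<in> S \<Longrightarrow> ln (cmod (poly p (of_real t))) / real n \<le> A"
    obtain \<rho> :: "nat \<Rightarrow> real" where \<rho>:
      "\<And>t. t \<notin> \<rho> ` {..<degree p} \<Longrightarrow> - ln (cmod (poly p (of_real t))) \<le>
         - ln (cmod (lead_coeff p)) + (\<Sum>k<degree p. max 0 (- ln \<bar>t - \<rho> k\<bar>))"
      using poly_ln_lower_bound[OF p] by blast
    define l where "l k t = max 0 (- ln \<bar>t - \<rho> k\<bar>)" for k t
    define u where "u t = ln (cmod (poly p (of_real t))) / real n" for t :: real
    have [measurable]: "l k \<in> borel_measurable borel" for k
      unfolding l_def by measurable
    have l0: "l k t \<ge> 0" for k t by (simp add: l_def)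
    have sq: "(u t)\<^sup>2 \<le> 2 * A\<^sup>2 + (2 * D / n) * (\<Sum>k<degree p. (l k t)\<^sup>2)"
      if t: "t \<in> S" "t \<notin> \<rho> ` {..<degree p}" for t
    proof -
      have "- u t \<le> (- ln (cmod (lead_coeff p)) + (\<Sum>k<degree p. l k t)) / n"
        unfolding u_def using divide_right_mono[OF \<rho>[OF t(2)], of n] by (simp add: l_def)
      also have "\<dots> \<le> A + (\<Sum>k<degree p. l k t) / n"
        using lc by (simp add: add_divide_distrib diff_divide_distrib)
      finally have lo: "- u t \<le> A + (\<Sum>k<degree p. l k t) / n" .
      have "0 \<le> (\<Sum>k<degree p. l k t) / n" by (intro divide_nonneg_nonneg sum_nonneg l0) auto
      with lo up[OF t(1)] have "\<bar>u t\<bar> \<le> A + (\<Sum>k<degree p. l k t) / n"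
        unfolding u_def by linarith
      then have "(u t)\<^sup>2 \<le> (A + (\<Sum>k<degree p. l k t) / n)\<^sup>2"
        by (metis abs_ge_zero power2_abs power_mono)
      also have "\<dots> \<le> 2 * A\<^sup>2 + 2 * ((\<Sum>k<degree p. l k t) / n)\<^sup>2"
        using sum_squares_bound[of A "(\<Sum>k<degree p. l k t) / n"] by (simp add: power2_sum)
      \<comment> \<open>Cauchy-Schwarz over \<open>degree p\<close> terms costs a factor of at most
        \<open>D * n\<close>, which leaves \<open>D / n\<close> after division by
        \<open>n\<^sup>2\<close>. Integrating the sum over the roots later supplies another
        \<open>D * n\<close>, whence the \<open>D\<^sup>2\<close> in the bound.\<close>
      also have "((\<Sum>k<degree p. l k t) / n)\<^sup>2 \<le> (\<Sum>k<degree p. (l k t)\<^sup>2) * degree p / n\<^sup>2"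
        using sum_squared_le_sum_of_squares[of "\<lambda>k. l k t" "{..<degree p}"]
        by (simp add: power_divide divide_right_mono)
      also have "\<dots> \<le> (\<Sum>k<degree p. (l k t)\<^sup>2) * (D * n) / n\<^sup>2"
        using deg by (intro divide_right_mono mult_left_mono sum_nonneg) (auto simp flip: of_nat_mult)
      also have "\<dots> = (D / n) * (\<Sum>k<degree p. (l k t)\<^sup>2)"
        using n by (simp add: power2_eq_square)
      finally show ?thesis by simp
    qed
    have "AE t in lborel. t \<notin> \<rho> ` {..<degree p}"
      by (intro AE_not_in finite_imp_null_set_lborel) auto
    then have "(\<integral>\<^sup>+t. ennreal ((u t)\<^sup>2) * indicator S t \<partial>lborel)
       \<le> (\<integral>\<^sup>+t. ennreal (2 * A\<^sup>2) * indicator {0..1} t +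
            ennreal (2 * D / n) * (\<Sum>k<degree p. ennreal ((l k t)\<^sup>2)) \<partial>lborel)"
    proof (intro nn_integral_mono_AE, eventually_elim)
      case (elim t)
      show ?case
      proof (cases "t \<in> S")
        case True
        then have "ennreal ((u t)\<^sup>2) \<le> ennreal (2 * A\<^sup>2 + (2 * D / n) * (\<Sum>k<degree p. (l k t)\<^sup>2))"
          using sq[OF True elim(2)] by (intro ennreal_leI)
        also have "\<dots> = ennreal (2 * A\<^sup>2) + ennreal (2 * D / n) * (\<Sum>k<degree p. ennreal ((l k t)\<^sup>2))"
          by (subst ennreal_plus) (auto simp: sum_nonneg simp flip: ennreal_mult)
        finally show ?thesis using True S by auto
      qed simp
    qed
    also have "\<dots> = ennreal (2 * A\<^sup>2) +
        ennreal (2 * D / n) * (\<Sum>k<degree p. \<integral>\<^sup>+t. ennreal ((l k t)\<^sup>2) \<partial>lborel)"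
      by (simp add: nn_integral_add nn_integral_cmult nn_integral_sum del: sum_ennreal)
    also have "\<dots> \<le> ennreal (2 * A\<^sup>2) + ennreal (2 * D / n) * (\<Sum>k<degree p. ennreal \<Lambda>)"
      by (intro add_left_mono mult_left_mono sum_mono) (auto simp: l_def \<Lambda>)
    also have "\<dots> = ennreal (2 * A\<^sup>2 + (2 * D / n) * (degree p * \<Lambda>))"
      using \<Lambda>(1) by (subst ennreal_plus) (auto simp: ennreal_of_nat_eq_real_of_nat simp flip: ennreal_mult)
    also have "\<dots> \<le> ennreal (2 * A\<^sup>2 + 2 * (real D)\<^sup>2 * \<Lambda>)"
    proof (intro ennreal_leI add_left_mono)
      have "(2 * D / n) * (degree p * \<Lambda>) \<le> (2 * D / n) * ((D * n) * \<Lambda>)"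
        using deg \<Lambda>(1) by (intro mult_left_mono mult_right_mono) (auto simp flip: of_nat_mult)
      also have "\<dots> = 2 * (real D)\<^sup>2 * \<Lambda>" using n by (simp add: power2_eq_square)
      finally show "(2 * D / n) * (degree p * \<Lambda>) \<le> 2 * (real D)\<^sup>2 * \<Lambda>" .
    qed
    finally show "(\<integral>\<^sup>+t. ennreal ((ln (cmod (poly p (of_real t))) / real n)\<^sup>2) * indicator S t \<partial>lborel)
         \<le> ennreal (2 * A\<^sup>2 + 2 * (real D)\<^sup>2 * \<Lambda>)"
      unfolding u_def .
  qed
qed

section \<open>Exponential growth rates of sums of powers\<close>

text \<open>With \<open>y i0 ^ n\<close> factored out, the remaining sum tends to 1, since every
  other ratio has modulus below 1. The logarithm of its modulus then tends to 0.\<close>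

lemma sum_powers_dominant_term:
  fixes y :: "'i \<Rightarrow> complex"
  assumes "finite I" "i0 \<in> I" "y i0 \<noteq> 0"
    and dom: "\<And>i. i \<in> I \<Longrightarrow> i \<noteq> i0 \<Longrightarrow> cmod (y i) < cmod (y i0)"
  shows "\<forall>\<^sub>F n in sequentially. (\<Sum>i\<in>I. y i ^ n) \<noteq> 0"
    and "(\<lambda>n. ln (cmod (\<Sum>i\<in>I. y i ^ n)) / real n) \<longlonglongrightarrow> ln (cmod (y i0))"
proof -
  define S where "S n = (\<Sum>i\<in>I. (y i / y i0) ^ n)" for n :: nat
  have "(\<lambda>n. (y i / y i0) ^ n) \<longlonglongrightarrow> (if i = i0 then 1 else 0)" if "i \<in> I" for i
  proof (cases "i = i0")
    case False
    then have "cmod (y i / y i0) < 1"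
      using dom[OF that] assms(3) by (simp add: norm_divide)
    then show ?thesis using False by (simp add: LIMSEQ_power_zero)
  qed (use assms in simp)
  then have "S \<longlonglongrightarrow> (\<Sum>i\<in>I. if i = i0 then 1 else 0)"
    unfolding S_def by (intro tendsto_sum)
  then have S: "S \<longlonglongrightarrow> 1" using assms by simp
  then have S0: "\<forall>\<^sub>F n in sequentially. S n \<noteq> 0"
    by (rule tendsto_imp_eventually_ne) simp
  have eq: "(\<Sum>i\<in>I. y i ^ n) = y i0 ^ n * S n" for n
    using assms by (simp add: S_def sum_distrib_left power_divide)
  show "\<forall>\<^sub>F n in sequentially. (\<Sum>i\<in>I. y i ^ n) \<noteq> 0"
    using S0 by eventually_elim (use assms eq in auto)
  have "(\<lambda>n. ln (cmod (S n))) \<longlonglongrightarrow> ln (cmod 1)"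
    by (intro tendsto_intros S) auto
  then have "(\<lambda>n. ln (cmod (S n)) * (1 / real n)) \<longlonglongrightarrow> ln (cmod 1) * 0"
    by (intro tendsto_mult lim_1_over_n)
  then have "(\<lambda>n. ln (cmod (y i0)) + ln (cmod (S n)) * (1 / real n)) \<longlonglongrightarrow> ln (cmod (y i0)) + 0"
    by (intro tendsto_add tendsto_const) simp
  moreover have "\<forall>\<^sub>F n in sequentially. ln (cmod (y i0)) + ln (cmod (S n)) * (1 / real n)
      = ln (cmod (\<Sum>i\<in>I. y i ^ n)) / real n"
    using S0 eventually_gt_at_top[of 0]
  proof eventually_elim
    case (elim n)
    then show ?case
      using assms(3) by (simp add: eq norm_mult norm_power ln_mult_pos ln_realpow add_divide_distrib)
  qed
  ultimately show "(\<lambda>n. ln (cmod (\<Sum>i\<in>I. y i ^ n)) / real n) \<longlonglongrightarrow> ln (cmod (y i0))"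
    by (auto intro: Lim_transform_eventually)
qed

text \<open>The summands are powers of the cofactors \<open>y i = P / x i\<close>, so the
  \<open>x i\<close> of least modulus gives the strictly dominant one. There are two applications:
  to the values of the affine functions at a point, for the pointwise limit, and to their linear
  parts at a direction, for the leading coefficients on lines.\<close>

lemma sum_cofactor_powers:
  fixes x :: "nat \<Rightarrow> complex"
  assumes d: "d \<ge> 1" and nz: "\<And>i. i < d \<Longrightarrow> x i \<noteq> 0"
    and dist: "\<And>i j. i < d \<Longrightarrow> j < d \<Longrightarrow> i \<noteq> j \<Longrightarrow> cmod (x i) \<noteq> cmod (x j)"
  shows "\<forall>\<^sub>F n in sequentially. (\<Sum>i<d. \<Prod>j\<in>{..<d} - {i}. x j ^ n) \<noteq> 0"
    and "(\<lambda>n. ln (cmod (\<Sum>i<d. \<Prod>j\<in>{..<d} - {i}. x j ^ n)) / real n)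
      \<longlonglongrightarrow> (MAX i\<in>{..<d}. ln (1 / cmod (x i))) + ln (cmod (\<Prod>i<d. x i))"
proof -
  define y where "y i = (\<Prod>j\<in>{..<d} - {i}. x j)" for i
  have fne: "finite {..<d}" "{..<d} \<noteq> {}" using d by (auto simp: lessThan_empty_iff)
  obtain i0 where i0: "i0 \<in> {..<d}" "\<And>i. i \<in> {..<d} \<Longrightarrow> cmod (x i0) \<le> cmod (x i)"
    using ex_min_if_finite[of "(\<lambda>i. cmod (x i)) ` {..<d}"] fne by (force simp: not_less)
  define P where "P = (\<Prod>i<d. x i)"
  have P0: "P \<noteq> 0" using nz by (auto simp: P_def)
  have y: "y i = P / x i" if "i < d" for i
    using prod.remove[of "{..<d}" i x] that nz[OF that] by (simp add: y_def P_def)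
  have y0: "y i0 \<noteq> 0" using P0 y[of i0] i0(1) nz by auto
  have less: "cmod (y i) < cmod (y i0)" if "i \<in> {..<d}" "i \<noteq> i0" for i
  proof -
    have "cmod (x i0) < cmod (x i)"
      using i0(2)[OF that(1)] dist[of i i0] that i0(1) by force
    then show ?thesis
      using y[of i] y[of i0] that i0(1) nz[of i] nz[of i0] P0
      by (auto simp: norm_divide intro!: divide_strict_left_mono)
  qed
  have "(MAX i\<in>{..<d}. ln (1 / cmod (x i))) = ln (1 / cmod (x i0))"
  proof (intro Max_eqI)
    fix s assume "s \<in> (\<lambda>i. ln (1 / cmod (x i))) ` {..<d}"
    then obtain i where i: "i < d" "s = ln (1 / cmod (x i))" by auto
    have "1 / cmod (x i) \<le> 1 / cmod (x i0)"
      using i0 i nz[of i0] by (intro divide_left_mono) (auto simp: nz)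
    then show "s \<le> ln (1 / cmod (x i0))"
      using i nz i0(1) by simp
  qed (use i0 in auto)
  then have lim: "(MAX i\<in>{..<d}. ln (1 / cmod (x i))) + ln (cmod (\<Prod>i<d. x i)) = ln (cmod (y i0))"
    using y[of i0] i0(1) nz[of i0] P0 by (simp add: P_def[symmetric] norm_divide ln_div)
  note * = sum_powers_dominant_term[of "{..<d}" i0 y, OF fne(1) i0(1) y0 less]
  show "\<forall>\<^sub>F n in sequentially. (\<Sum>i<d. \<Prod>j\<in>{..<d} - {i}. x j ^ n) \<noteq> 0"
    using *(1) by (simp add: y_def prod_power_distrib)
  show "(\<lambda>n. ln (cmod (\<Sum>i<d. \<Prod>j\<in>{..<d} - {i}. x j ^ n)) / real n)
      \<longlonglongrightarrow> (MAX i\<in>{..<d}. ln (1 / cmod (x i))) + ln (cmod (\<Prod>i<d. x i))"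
    using *(2) by (simp add: lim) (simp add: y_def prod_power_distrib)
qed

section \<open>Affine functions and negligible exceptional sets\<close>

lemma aff_line: "aff a b (z + t *\<^sub>R v) = aff a b z + of_real t * aff a 0 v"
  by (simp add: aff_def distrib_left sum.distrib sum_distrib_left)
    (simp add: scaleR_conv_of_real mult_ac)

lemma continuous_on_aff [continuous_intros]: "continuous_on S (aff a b)"
  unfolding aff_def by (intro continuous_intros)

lemma borel_measurable_aff [measurable]: "aff a b \<in> borel_measurable borel"
  by (intro borel_measurable_continuous_onI continuous_on_aff)

text \<open>On a line in direction \<open>w\<close> the difference of the squared moduli is a
  quadratic polynomial \<open>q\<close> in the real parameter. Its top coefficient is the difference
  of the squared moduli of the linear parts at \<open>w\<close>, nonzero by \<open>ne\<close>, so
  the line meets the set in finitely many points.\<close>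

lemma null_sets_equal_modulus:
  fixes a a' :: "complex^'m"
  assumes ne: "cmod (aff a 0 w) \<noteq> cmod (aff a' 0 w)"
  shows "{z. cmod (aff a b z) = cmod (aff a' b' z)} \<in> null_sets lborel"
proof (rule null_sets_lborel_lines[where v = w])
  show "{z. cmod (aff a b z) = cmod (aff a' b' z)} \<in> sets borel"
    by measurable
  fix z
  define \<alpha> \<beta> \<alpha>' \<beta>' where "\<alpha> = aff a b z" "\<beta> = aff a 0 w" "\<alpha>' = aff a' b' z" "\<beta>' = aff a' 0 w"
  note defs = this
  define q where "q = [:(cmod \<alpha>)\<^sup>2 - (cmod \<alpha>')\<^sup>2, 2 * Re (\<alpha> * cnj \<beta>) - 2 * Re (\<alpha>' * cnj \<beta>'),
     (cmod \<beta>)\<^sup>2 - (cmod \<beta>')\<^sup>2:]"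
  have sq: "(cmod (x + of_real t * y))\<^sup>2 = (cmod x)\<^sup>2 + t * (2 * Re (x * cnj y)) + t\<^sup>2 * (cmod y)\<^sup>2"
    for x y :: complex and t
    unfolding cmod_power2 by (simp add: power2_eq_square algebra_simps)
  have "(cmod \<beta>)\<^sup>2 \<noteq> (cmod \<beta>')\<^sup>2"
    using ne by (simp add: defs)
  then have "q \<noteq> 0" by (simp add: q_def)
  then have "finite {t. poly q t = 0}" by (rule poly_roots_finite)
  moreover have "{t. z + t *\<^sub>R w \<in> {z. cmod (aff a b z) = cmod (aff a' b' z)}} \<subseteq> {t. poly q t = 0}"
  proof (clarsimp simp: aff_line defs[symmetric])
    fix t assume "cmod (\<alpha> + of_real t * \<beta>) = cmod (\<alpha>' + of_real t * \<beta>')"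
    then have "(cmod (\<alpha> + of_real t * \<beta>))\<^sup>2 = (cmod (\<alpha>' + of_real t * \<beta>'))\<^sup>2" by simp
    then show "poly q t = 0"
      unfolding sq q_def by (simp add: algebra_simps power2_eq_square)
  qed
  ultimately show "finite {t. z + t *\<^sub>R w \<in> {z. cmod (aff a b z) = cmod (aff a' b' z)}}"
    by (rule rev_finite_subset)
qed

text \<open>The zero set is where the modulus agrees with that of the zero affine function.\<close>

lemma null_sets_aff_zero:
  assumes "aff a 0 w \<noteq> 0"
  shows "{z. aff a b z = 0} \<in> null_sets lborel"
  using null_sets_equal_modulus[of a w 0 b 0] assms by (simp add: aff_def)

text \<open>At the conjugate \<open>w\<close> of \<open>a\<close> the first form takes the value 1
  and the second the Hermitian product \<open>c\<close> of \<open>a'\<close> and \<open>a\<close>.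
  If \<open>c\<close> had modulus 1, the equality case of Cauchy-Schwarz, obtained here by expanding
  the squared norm of \<open>a' - c *s a\<close>, would give \<open>a' = c *s a\<close>.\<close>

lemma unit_vectors_separating_direction:
  fixes a a' :: "complex^'m"
  assumes na: "norm a = 1" and na': "norm a' = 1" and indep: "\<And>c. a' \<noteq> c *s a"
  shows "\<exists>w. cmod (aff a 0 w) \<noteq> cmod (aff a' 0 w)"
proof -
  have sq: "(\<Sum>k\<in>UNIV. x $ k * cnj (x $ k)) = of_real ((norm x)\<^sup>2)" for x :: "complex^'m"
    by (simp add: norm_vec_def L2_set_def complex_norm_square[symmetric] sum_nonneg del: of_real_power)
  define w where "w = (\<chi> k. cnj (a $ k))"
  define c where "c = aff a' 0 w"
  have c: "c = (\<Sum>k\<in>UNIV. a' $ k * cnj (a $ k))"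
    by (simp add: c_def aff_def w_def)
  have cc: "cnj c = (\<Sum>k\<in>UNIV. a $ k * cnj (a' $ k))"
    by (simp add: c mult.commute)
  have "aff a 0 w = 1"
    using sq[of a] na by (simp add: aff_def w_def)
  moreover have "cmod c \<noteq> 1"
  proof
    assume c1: "cmod c = 1"
    have "complex_of_real ((norm (a' - c *s a))\<^sup>2)
        = (\<Sum>k\<in>UNIV. (a' $ k - c * a $ k) * (cnj (a' $ k) - cnj c * cnj (a $ k)))"
      by (subst sq[symmetric]) simp
    also have "\<dots> = (\<Sum>k\<in>UNIV. a' $ k * cnj (a' $ k)) - cnj c * (\<Sum>k\<in>UNIV. a' $ k * cnj (a $ k))
        - c * (\<Sum>k\<in>UNIV. a $ k * cnj (a' $ k)) + c * cnj c * (\<Sum>k\<in>UNIV. a $ k * cnj (a $ k))"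
      by (simp add: sum_distrib_left algebra_simps sum.distrib sum_subtractf)
    also have "\<dots> = 1 - c * cnj c"
      using sq[of a] sq[of a'] na na' by (simp add: c[symmetric] cc[symmetric])
    also have "\<dots> = 0"
      using c1 by (simp add: complex_norm_square[symmetric])
    finally have "a' = c *s a" by (simp del: of_real_power)
    then show False using indep by simp
  qed
  ultimately show ?thesis
    by (intro exI[of _ w]) (auto simp: c_def)
qed

lemma not_UNIV_if_null:
  assumes "N \<in> null_sets (lborel :: 'a::euclidean_space measure)"
  shows "\<exists>v. v \<notin> N"
proof (rule ccontr)
  assume "\<not> ?thesis"
  then have "N = UNIV" by auto
  then show False using assms by (simp add: null_sets_def emeasure_lborel_UNIV)
qed

section \<open>Passage to the limit under a square-integral bound\<close>

text \<open>This is a Vitali-type argument. Fatou passes the bound on to \<open>g\<close>; the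
  difference is then cut at a height \<open>T\<close>, with dominated convergence below it and the
  square bounds above it.\<close>

lemma integral_tendsto_if_L2_bounded:
  fixes f :: "nat \<Rightarrow> 'a \<Rightarrow> 'b::{banach, second_countable_topology}"
  assumes "finite_measure M"
    and [measurable]: "\<And>n. f n \<in> borel_measurable M" "g \<in> borel_measurable M"
    and lim: "AE x in M. (\<lambda>n. f n x) \<longlonglongrightarrow> g x"
    and bound: "\<And>n. (\<integral>\<^sup>+x. ennreal ((norm (f n x))\<^sup>2) \<partial>M) \<le> ennreal C"
  shows "(\<lambda>n. integral\<^sup>L M (f n)) \<longlonglongrightarrow> integral\<^sup>L M g"
proof -
  interpret finite_measure M by fact
  have "(\<integral>\<^sup>+x. ennreal ((norm (g x))\<^sup>2) \<partial>M) = (\<integral>\<^sup>+x. liminf (\<lambda>n. ennreal ((norm (f n x))\<^sup>2)) \<partial>M)"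
    using lim
  proof (intro nn_integral_cong_AE, eventually_elim)
    case (elim x)
    then have "(\<lambda>n. ennreal ((norm (f n x))\<^sup>2)) \<longlonglongrightarrow> ennreal ((norm (g x))\<^sup>2)"
      by (intro tendsto_intros)
    then show ?case by (rule lim_imp_Liminf[symmetric, OF sequentially_bot])
  qed
  also have "\<dots> \<le> liminf (\<lambda>n. \<integral>\<^sup>+x. ennreal ((norm (f n x))\<^sup>2) \<partial>M)"
    by (intro nn_integral_liminf) measurable
  also have "\<dots> \<le> liminf (\<lambda>n::nat. ennreal C)"
    by (intro Liminf_mono always_eventually allI bound)
  finally have boundg: "(\<integral>\<^sup>+x. ennreal ((norm (g x))\<^sup>2) \<partial>M) \<le> ennreal C"
    by (simp add: Liminf_const)
  \<comment> \<open>\<open>C\<close> carries no sign condition and \<open>ennreal C\<close> is 0 for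
    negative \<open>C\<close>, so the real bound is \<open>max 0 C\<close>.\<close>
  have sq_int: "integrable M (\<lambda>x. (norm (h x))\<^sup>2)" and int: "integrable M h"
    and sq_le: "(\<integral>x. (norm (h x))\<^sup>2 \<partial>M) \<le> max 0 C"
    if h [measurable]: "h \<in> borel_measurable M"
      and b: "(\<integral>\<^sup>+x. ennreal ((norm (h x))\<^sup>2) \<partial>M) \<le> ennreal C" for h :: "'a \<Rightarrow> 'b"
  proof -
    have "(\<integral>\<^sup>+x. ennreal ((norm (h x))\<^sup>2) \<partial>M) < \<infinity>"
      using b by (rule le_less_trans) simp
    then show 1: "integrable M (\<lambda>x. (norm (h x))\<^sup>2)"
      by (intro integrableI_bounded) simp_all
    have le: "norm (h x) \<le> norm (1 + (norm (h x))\<^sup>2)" for x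
      using sum_squares_bound[of 1 "norm (h x)"] norm_ge_zero[of "h x"] by (auto simp: abs_if)
    have "integrable M (\<lambda>x. 1 + (norm (h x))\<^sup>2)"
      using 1 by simp
    then show "integrable M h"
      by (rule Bochner_Integration.integrable_bound) (use le in simp_all)
    have "ennreal (\<integral>x. (norm (h x))\<^sup>2 \<partial>M) \<le> ennreal (max 0 C)"
      using b 1 by (subst nn_integral_eq_integral[symmetric]) (auto simp: max_def ennreal_neg)
    then show "(\<integral>x. (norm (h x))\<^sup>2 \<partial>M) \<le> max 0 C"
      by (subst (asm) ennreal_le_iff) auto
  qed
  have f_int: "integrable M (\<lambda>x. (norm (f n x))\<^sup>2)" "integrable M (f n)"
    "(\<integral>x. (norm (f n x))\<^sup>2 \<partial>M) \<le> max 0 C" for n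
    by (rule sq_int[OF _ bound] int[OF _ bound] sq_le[OF _ bound], measurable)+
  have g_int: "integrable M (\<lambda>x. (norm (g x))\<^sup>2)" "integrable M g"
    "(\<integral>x. (norm (g x))\<^sup>2 \<partial>M) \<le> max 0 C"
    by (rule sq_int[OF _ boundg] int[OF _ boundg] sq_le[OF _ boundg], measurable)+
  have L1: "(\<lambda>n. \<integral>x. norm (f n x - g x) \<partial>M) \<longlonglongrightarrow> 0"
  proof (rule LIMSEQ_I)
    fix e :: real assume e: "e > 0"
    \<comment> \<open>The part above \<open>T\<close> costs at most \<open>4 * max 0 C / T\<close>,
      which this choice puts below \<open>e / 2\<close>; the summand 1 keeps \<open>T\<close>
      positive when \<open>C \<le> 0\<close>.\<close>
    define T where "T = (8 * max 0 C + 1) / e"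
    have T: "T > 0" using e by (simp add: T_def add_nonneg_pos)
    have "(\<lambda>n. \<integral>x. min (norm (f n x - g x)) T \<partial>M) \<longlonglongrightarrow> (\<integral>x. 0 \<partial>M)"
    proof (rule integral_dominated_convergence[where w = "\<lambda>_. T"])
      show "AE x in M. (\<lambda>n. min (norm (f n x - g x)) T) \<longlonglongrightarrow> 0"
        using lim
      proof eventually_elim
        case (elim x)
        have "(\<lambda>n. min (norm (f n x - g x)) T) \<longlonglongrightarrow> min (norm (g x - g x)) T"
          by (intro tendsto_intros elim)
        then show ?case using T by simp
      qed
    qed (use T in auto)
    then obtain N where N: "\<And>n. n \<ge> N \<Longrightarrow> \<bar>\<integral>x. min (norm (f n x - g x)) T \<partial>M\<bar> < e / 2"
      using LIMSEQ_D[of _ 0 "e/2"] e by force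
    have "norm ((\<integral>x. norm (f n x - g x) \<partial>M) - 0) < e" if n: "n \<ge> N" for n
    proof -
      \<comment> \<open>Where the difference exceeds \<open>T\<close>, it is at most its square
        divided by \<open>T\<close>.\<close>
      have pw: "norm (f n x - g x) \<le> min (norm (f n x - g x)) T
          + (2 / T * (norm (f n x))\<^sup>2 + 2 / T * (norm (g x))\<^sup>2)" for x
      proof (cases "norm (f n x - g x) \<le> T")
        case True
        then show ?thesis using T by (simp add: min_def)
      next
        case False
        have "norm (f n x - g x) \<le> norm (f n x) + norm (g x)" by (rule norm_triangle_ineq4)
        then have "(norm (f n x - g x))\<^sup>2 \<le> (norm (f n x) + norm (g x))\<^sup>2"
          by (intro power_mono) auto
        also have "\<dots> \<le> 2 * (norm (f n x))\<^sup>2 + 2 * (norm (g x))\<^sup>2"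
          using sum_squares_bound[of "norm (f n x)" "norm (g x)"] by (simp add: power2_sum)
        finally have *: "(norm (f n x - g x))\<^sup>2 \<le> 2 * (norm (f n x))\<^sup>2 + 2 * (norm (g x))\<^sup>2" .
        have "T * norm (f n x - g x) \<le> (norm (f n x - g x))\<^sup>2"
          unfolding power2_eq_square using False by (intro mult_right_mono) auto
        with * have "norm (f n x - g x) \<le> (2 * (norm (f n x))\<^sup>2 + 2 * (norm (g x))\<^sup>2) / T"
          using T by (simp add: field_simps)
        then show ?thesis using False T by (simp add: min_def add_divide_distrib)
      qed
      have i1: "integrable M (\<lambda>x. min (norm (f n x - g x)) T)"
        using T by (intro integrable_const_bound[where B = T]) auto
      have "(\<integral>x. norm (f n x - g x) \<partial>M) \<le> (\<integral>x. min (norm (f n x - g x)) T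
          + (2 / T * (norm (f n x))\<^sup>2 + 2 / T * (norm (g x))\<^sup>2) \<partial>M)"
        using f_int g_int i1 by (intro integral_mono pw Bochner_Integration.integrable_add
            Bochner_Integration.integrable_diff integrable_norm integrable_mult_right)
      also have "\<dots> = (\<integral>x. min (norm (f n x - g x)) T \<partial>M)
          + (2 / T * (\<integral>x. (norm (f n x))\<^sup>2 \<partial>M) + 2 / T * (\<integral>x. (norm (g x))\<^sup>2 \<partial>M))"
        using f_int(1)[of n] g_int(1) i1 by simp
      also have "\<dots> \<le> (\<integral>x. min (norm (f n x - g x)) T \<partial>M) + (2 / T * max 0 C + 2 / T * max 0 C)"
        using f_int(3)[of n] g_int(3) T by (intro add_mono mult_left_mono) auto
      also have "2 / T * max 0 C + 2 / T * max 0 C = (4 * max 0 C) / T"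
        by simp
      also have "\<dots> < e / 2"
        using T e by (simp add: T_def field_simps)
      also have "(\<integral>x. min (norm (f n x - g x)) T \<partial>M) < e / 2"
        using N[OF n] by linarith
      finally show ?thesis by simp
    qed
    then show "\<exists>no. \<forall>n\<ge>no. norm ((\<integral>x. norm (f n x - g x) \<partial>M) - 0) < e" by blast
  qed
  have "\<forall>\<^sub>F n in sequentially. norm (integral\<^sup>L M (f n) - integral\<^sup>L M g) \<le> (\<integral>x. norm (f n x - g x) \<partial>M)"
  proof (intro always_eventually allI)
    fix n
    show "norm (integral\<^sup>L M (f n) - integral\<^sup>L M g) \<le> (\<integral>x. norm (f n x - g x) \<partial>M)"
      using integral_norm_bound[of M "\<lambda>x. f n x - g x"] f_int(2)[of n] g_int(2) by simp
  qed
  then have "(\<lambda>n. integral\<^sup>L M (f n) - integral\<^sup>L M g) \<longlonglongrightarrow> 0"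
    using L1 by (rule Lim_null_comparison)
  then show ?thesis by (rule LIM_zero_cancel)
qed

section \<open>Second derivatives of test functions\<close>

lemma smooth_fun_differentiable: "smooth_fun f \<Longrightarrow> f differentiable (at x)"
  by (auto elim: smooth_fun.cases)

lemma smooth_fun_dir_deriv: "smooth_fun f \<Longrightarrow> smooth_fun (dir_deriv f v)"
  by (auto elim: smooth_fun.cases)

lemma smooth_fun_continuous_on: "smooth_fun f \<Longrightarrow> continuous_on S f"
  by (meson smooth_fun_differentiable continuous_at_imp_continuous_on differentiable_imp_continuous_within)

text \<open>The derivative is local. Applied to the complement of the support, this confines the
  derivatives of a test function to that support.\<close>

lemma dir_deriv_eq_zero:
  assumes "open S" "x \<in> S" "\<And>y. y \<in> S \<Longrightarrow> f y = 0"
  shows "dir_deriv f v x = 0"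
proof -
  have "(f has_derivative (\<lambda>_. 0)) (at x)"
    by (rule has_derivative_transform_within_open[OF has_derivative_const assms(1,2)])
      (use assms(3) in auto)
  then show ?thesis
    by (simp add: dir_deriv_def frechet_derivative_at[symmetric])
qed

text \<open>\<open>smooth_fun\<close> directly supplies iterated directional derivatives. Expanding
  the Wirtinger operators into them reduces continuity and support to these terms.\<close>

lemma wirt_dz_wirt_dzbar:
  assumes "smooth_fun g"
  shows "wirt_dz (wirt_dzbar g k) j x =
    (dir_deriv (dir_deriv g (axis k 1)) (axis j 1) x
      + \<i> * dir_deriv (dir_deriv g (axis k \<i>)) (axis j 1) x
      - \<i> * (dir_deriv (dir_deriv g (axis k 1)) (axis j \<i>) x
      + \<i> * dir_deriv (dir_deriv g (axis k \<i>)) (axis j \<i>) x)) / 4"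
proof -
  define A B where "A = dir_deriv g (axis k 1)" "B = dir_deriv g (axis k \<i>)"
  note AB = this
  have D: "(h has_derivative frechet_derivative h (at x)) (at x)" if "h \<in> {A, B}" for h
    using that assms frechet_derivative_works smooth_fun_differentiable smooth_fun_dir_deriv
    unfolding AB by blast
  have "((\<lambda>x. (A x + \<i> * B x) / 2) has_derivative
      (\<lambda>v. (frechet_derivative A (at x) v + \<i> * frechet_derivative B (at x) v) / 2)) (at x)"
    by (auto intro!: derivative_eq_intros D)
  moreover have "wirt_dzbar g k = (\<lambda>x. (A x + \<i> * B x) / 2)"
    by (auto simp: wirt_dzbar_def AB)
  ultimately have *: "dir_deriv (wirt_dzbar g k) v x = (dir_deriv A v x + \<i> * dir_deriv B v x) / 2" for v
    by (simp add: dir_deriv_def frechet_derivative_at[symmetric])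
  show ?thesis
    unfolding wirt_dz_def * unfolding AB by (simp add: algebra_simps add_divide_distrib diff_divide_distrib)
qed

text \<open>The pairing sees a test function only through this derivative, which acts as a bounded
  weight on a compact set.\<close>

lemma wirt_dz_wirt_dzbar_bounded_support:
  assumes "test_fun g"
  obtains K B where "compact K" "\<And>x. x \<notin> K \<Longrightarrow> wirt_dz (wirt_dzbar g k) j x = 0"
    "\<And>x. cmod (wirt_dz (wirt_dzbar g k) j x) \<le> B" "B \<ge> 0"
    "wirt_dz (wirt_dzbar g k) j \<in> borel_measurable borel"
proof -
  define K where "K = closure {x. g x \<noteq> 0}"
  let ?\<phi> = "wirt_dz (wirt_dzbar g k) j"
  have sm: "smooth_fun g" and K: "compact K" using assms by (auto simp: test_fun_def K_def)
  have 1: "dir_deriv g v x = 0" if "x \<in> - K" for v x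
    by (rule dir_deriv_eq_zero[of "- K"]) (use that closure_subset[of "{x. g x \<noteq> 0}"] in \<open>auto simp: K_def\<close>)
  have 2: "dir_deriv (dir_deriv g v) w x = 0" if "x \<in> - K" for v w x
    by (rule dir_deriv_eq_zero[of "- K"]) (use that 1 in \<open>auto simp: K_def\<close>)
  have zero: "?\<phi> x = 0" if "x \<notin> K" for x
    using that by (simp add: wirt_dz_wirt_dzbar[OF sm] 2)
  have "continuous_on UNIV (dir_deriv (dir_deriv g v) w)" for v w
    by (intro smooth_fun_continuous_on smooth_fun_dir_deriv sm)
  then have cont: "continuous_on UNIV ?\<phi>"
    unfolding wirt_dz_wirt_dzbar[OF sm, abs_def] by (intro continuous_intros) auto
  then have "bounded (?\<phi> ` K)"
    by (intro compact_imp_bounded compact_continuous_image K) (auto intro: continuous_on_subset)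
  then obtain B where B: "B > 0" "\<And>x. x \<in> K \<Longrightarrow> cmod (?\<phi> x) \<le> B"
    by (force simp: bounded_pos)
  show thesis
  proof (rule that[OF K zero])
    show "cmod (?\<phi> x) \<le> B" for x
      using B zero[of x] by (cases "x \<in> K") auto
  qed (use B cont in \<open>auto intro: borel_measurable_continuous_onI\<close>)
qed

section \<open>Uniform bounds for the cofactor sums\<close>

text \<open>There are \<open>d\<close> summands, each a product of \<open>d - 1\<close> powers;
  since \<open>R \<ge> 1\<close>, the exponent may be raised from \<open>(d - 1) * n\<close> to
  \<open>d * n\<close>.\<close>

lemma cofactor_sum_upper_bound:
  fixes x :: "nat \<Rightarrow> complex"
  assumes d: "d \<ge> 1" and n: "n > 0" and R: "R \<ge> 1" and x: "\<And>j. j < d \<Longrightarrow> cmod (x j) \<le> R"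
  shows "ln (cmod (\<Sum>i<d. \<Prod>j\<in>{..<d} - {i}. x j ^ n)) / real n \<le> ln (real d) + real d * ln R"
    (is "ln (cmod ?Q) / _ \<le> _")
proof (cases "?Q = 0")
  case False
  have "cmod (\<Prod>j\<in>{..<d} - {i}. x j ^ n) \<le> R ^ (d * n)" for i
  proof -
    have "cmod (\<Prod>j\<in>{..<d} - {i}. x j ^ n) \<le> (\<Prod>j\<in>{..<d} - {i}. R ^ n)"
      unfolding prod_norm[symmetric] norm_power
      using x by (intro prod_mono conjI power_mono) auto
    also have "\<dots> = R ^ (n * card ({..<d} - {i}))"
      by (simp add: power_mult)
    also have "\<dots> \<le> R ^ (d * n)"
      using R card_mono[of "{..<d}" "{..<d} - {i}"] by (intro power_increasing) auto
    finally show ?thesis .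
  qed
  then have "cmod ?Q \<le> real (card {..<d}) * R ^ (d * n)"
    by (intro sum_norm_bound)
  then have "ln (cmod ?Q) \<le> ln (real d * R ^ (d * n))"
    using False d R by (subst ln_le_cancel_iff) auto
  also have "\<dots> = ln (real d) + real d * real n * ln R"
    using d R by (simp add: ln_mult_pos ln_realpow)
  finally have "ln (cmod ?Q) / real n \<le> ln (real d) / real n + real d * ln R"
    using n by (simp add: field_simps)
  moreover have "ln (real d) / real n \<le> ln (real d)"
    using divide_left_mono[of 1 "real n" "ln (real d)"] d n by simp
  ultimately show ?thesis by simp
next
  case True
  \<comment> \<open>Here \<open>ln 0 = 0\<close> on the left, and the right side is nonnegative
    because \<open>d \<ge> 1\<close> and \<open>R \<ge> 1\<close>.\<close>
  show ?thesis unfolding True using d R by simp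
qed

text \<open>As no \<open>\<beta> i\<close> vanishes, all products have the same degree and their top
  coefficients add up; \<open>c\<close> excludes cancellation. The leading coefficient is free of
  \<open>\<alpha>\<close>, hence of the position of the line.\<close>

lemma cofactor_sum_line_poly:
  fixes \<alpha> \<beta> :: "nat \<Rightarrow> complex"
  assumes nz: "\<And>i. i < d \<Longrightarrow> \<beta> i \<noteq> 0"
    and c: "(\<Sum>i<d. \<Prod>j\<in>{..<d} - {i}. \<beta> j ^ n) \<noteq> 0"
  obtains p where "p \<noteq> 0" "degree p = (d - 1) * n"
    "lead_coeff p = (\<Sum>i<d. \<Prod>j\<in>{..<d} - {i}. \<beta> j ^ n)"
    "\<And>t. poly p t = (\<Sum>i<d. \<Prod>j\<in>{..<d} - {i}. (\<alpha> j + t * \<beta> j) ^ n)"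
proof -
  define q where "q i = (\<Prod>j\<in>{..<d} - {i}. [:\<alpha> j, \<beta> j:] ^ n)" for i
  have degq: "degree (q i) = (d - 1) * n" if "i < d" for i
    unfolding q_def using nz that by (subst degree_prod_sum_eq) (auto simp: degree_power_eq)
  have "coeff (q i) ((d - 1) * n) = (\<Prod>j\<in>{..<d} - {i}. \<beta> j ^ n)" if "i < d" for i
  proof -
    have "lead_coeff (q i) = (\<Prod>j\<in>{..<d} - {i}. \<beta> j ^ n)"
      unfolding q_def lead_coeff_prod lead_coeff_power by (intro prod.cong) (auto simp: nz)
    then show ?thesis by (simp add: degq[OF that])
  qed
  then have co: "coeff (\<Sum>i<d. q i) ((d - 1) * n) = (\<Sum>i<d. \<Prod>j\<in>{..<d} - {i}. \<beta> j ^ n)"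
    by (simp add: coeff_sum)
  have "degree (\<Sum>i<d. q i) \<le> (d - 1) * n"
    by (intro degree_sum_le) (auto simp: degq)
  then have deg: "degree (\<Sum>i<d. q i) = (d - 1) * n"
    using c co by (intro antisym le_degree) auto
  show thesis
  proof (rule that[of "\<Sum>i<d. q i"])
    show "(\<Sum>i<d. q i) \<noteq> 0" using co c by force
    show "poly (\<Sum>i<d. q i) t = (\<Sum>i<d. \<Prod>j\<in>{..<d} - {i}. (\<alpha> j + t * \<beta> j) ^ n)" for t
      by (simp add: q_def poly_sum poly_prod)
  qed (use deg co in auto)
qed

text \<open>The leading coefficient \<open>c n\<close> is common to all lines in direction
  \<open>v\<close>, and \<open>ln (cmod (c n)) / real n\<close> converges, hence is bounded. The
  one-variable estimate therefore holds with one constant on all segments. The bound starts at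
  \<open>n0\<close> because \<open>c n\<close> may vanish for small \<open>n\<close>.\<close>

lemma cofactor_sum_L2_bound:
  fixes a :: "nat \<Rightarrow> complex^'m" and b :: "nat \<Rightarrow> complex" and v :: "complex^'m"
  assumes d: "d \<ge> 1" and nz: "\<And>i. i < d \<Longrightarrow> aff (a i) 0 v \<noteq> 0"
    and dist: "\<And>i j. i < d \<Longrightarrow> j < d \<Longrightarrow> i \<noteq> j \<Longrightarrow> cmod (aff (a i) 0 v) \<noteq> cmod (aff (a j) 0 v)"
    and K: "compact K"
  obtains C n0 where "C \<ge> 0" "\<And>n. n \<ge> n0 \<Longrightarrow>
    (\<integral>\<^sup>+z. ennreal ((ln (cmod (\<Sum>i<d. \<Prod>j\<in>{..<d} - {i}. (aff (a j) (b j) z) ^ n)) / real n)\<^sup>2)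
       * indicator K z \<partial>lborel) \<le> ennreal C"
proof -
  define \<beta> where "\<beta> i = aff (a i) 0 v" for i
  define c where "c n = (\<Sum>i<d. \<Prod>j\<in>{..<d} - {i}. \<beta> j ^ n)" for n :: nat
  define u where "u n z = ln (cmod (\<Sum>i<d. \<Prod>j\<in>{..<d} - {i}. (aff (a j) (b j) z) ^ n)) / real n"
    for n z
  have [measurable]: "K \<in> sets borel" using K by (simp add: compact_imp_closed)
  have [measurable]: "u n \<in> borel_measurable borel" for n
    unfolding u_def by measurable
  note cof = sum_cofactor_powers[of d \<beta>, OF d]
  have "\<forall>\<^sub>F n in sequentially. c n \<noteq> 0"
    unfolding c_def by (rule cof(1)) (use nz dist in \<open>auto simp: \<beta>_def\<close>)
  then obtain n1 where n1: "\<And>n. n \<ge> n1 \<Longrightarrow> c n \<noteq> 0" by (auto simp: eventually_sequentially)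
  have "convergent (\<lambda>n. ln (cmod (c n)) / real n)"
    unfolding c_def by (rule convergentI, rule cof(2)) (use nz dist in \<open>auto simp: \<beta>_def\<close>)
  then have "Bseq (\<lambda>n. ln (cmod (c n)) / real n)" by (rule convergent_imp_Bseq)
  then obtain A1 where A1: "\<And>n. \<bar>ln (cmod (c n)) / real n\<bar> \<le> A1"
    unfolding Bseq_def real_norm_def by blast
  have "bounded (\<Union>j<d. aff (a j) (b j) ` K)"
    by (intro bounded_UN finite_lessThan ballI compact_imp_bounded compact_continuous_image
        continuous_on_aff K)
  then obtain R where R: "\<And>z j. z \<in> K \<Longrightarrow> j < d \<Longrightarrow> cmod (aff (a j) (b j) z) \<le> R"
    unfolding bounded_iff by blast
  \<comment> \<open>One number has to bound both \<open>u n\<close> from above on \<open>K\<close>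
    and minus the normalised logarithm of the leading coefficient; the sum of two nonnegative bounds
    does both.\<close>
  define A where "A = A1 + (ln (real d) + real d * ln (max 1 R))"
  have A1_0: "A1 \<ge> 0" using A1[of 0] by simp
  have A2_0: "ln (real d) + real d * ln (max 1 R) \<ge> 0" using d by simp
  have up: "u n z \<le> A" if "n > 0" "z \<in> K" for n z
  proof -
    have "u n z \<le> ln (real d) + real d * ln (max 1 R)"
      unfolding u_def
    proof (rule cofactor_sum_upper_bound[OF d that(1)])
      show "cmod (aff (a j) (b j) z) \<le> max 1 R" if "j < d" for j
        using R[OF \<open>z \<in> K\<close> that] by simp
    qed simp
    then show ?thesis using A1_0 by (simp add: A_def)
  qed
  obtain \<Lambda> :: real where \<Lambda>: "\<Lambda> \<ge> 0"
    "\<And>(p :: complex poly) n D A S. p \<noteq> 0 \<Longrightarrow> n > 0 \<Longrightarrow> degree p \<le> D * n \<Longrightarrow> A \<ge> 0 \<Longrightarrow>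
       - ln (cmod (lead_coeff p)) / real n \<le> A \<Longrightarrow> S \<subseteq> {0..1} \<Longrightarrow>
       (\<And>t. t \<in> S \<Longrightarrow> ln (cmod (poly p (of_real t))) / real n \<le> A) \<Longrightarrow>
       (\<integral>\<^sup>+t. ennreal ((ln (cmod (poly p (of_real t))) / real n)\<^sup>2) * indicator S t \<partial>lborel)
         \<le> ennreal (2 * A\<^sup>2 + 2 * (real D)\<^sup>2 * \<Lambda>)"
    using poly_ln_square_integral_bound by blast
  define C0 where "C0 = 2 * A\<^sup>2 + 2 * (real (d - 1))\<^sup>2 * \<Lambda>"
  have C0: "C0 \<ge> 0" using \<Lambda>(1) by (simp add: C0_def)
  obtain r where r: "\<And>z. z \<in> K \<Longrightarrow> norm z \<le> r"
    using compact_imp_bounded[OF K] by (auto simp: bounded_iff)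
  \<comment> \<open>The ball contains every base point whose segment in direction \<open>v\<close>
    meets \<open>K\<close>, so the slice bound \<open>C0\<close> is integrated only over a set of
    finite measure.\<close>
  define B where "B = cball (0::complex^'m) (r + norm v)"
  have [measurable]: "B \<in> sets borel" by (simp add: B_def)
  have Bfin: "emeasure lborel B < \<infinity>"
    unfolding B_def by (intro emeasure_bounded_finite) auto
  show thesis
  proof (rule that[of "C0 * measure lborel B" "max 1 n1"])
    show "C0 * measure lborel B \<ge> 0" using C0 by simp
    fix n assume "n \<ge> max 1 n1"
    then have n: "n > 0" "n \<ge> n1" by auto
    have slice: "(\<integral>\<^sup>+t. ennreal ((u n (z + t *\<^sub>R v))\<^sup>2) * indicator K (z + t *\<^sub>R v) * indicator {0..1} t \<partial>lborel)
        \<le> ennreal C0 * indicator B z" for z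
    proof (cases "z \<in> B")
      case True
      obtain p where p: "p \<noteq> 0" "degree p = (d - 1) * n" "lead_coeff p = c n"
        "\<And>t. poly p t = (\<Sum>i<d. \<Prod>j\<in>{..<d} - {i}. (aff (a j) (b j) z + t * \<beta> j) ^ n)"
      proof (rule cofactor_sum_line_poly[of d \<beta> n "\<lambda>j. aff (a j) (b j) z"])
        show "\<beta> i \<noteq> 0" if "i < d" for i
          unfolding \<beta>_def by (rule nz[OF that])
        show "(\<Sum>i<d. \<Prod>j\<in>{..<d} - {i}. \<beta> j ^ n) \<noteq> 0"
          using n1[OF n(2)] unfolding c_def .
      qed (rule that, auto simp only: c_def)
      have pu: "ln (cmod (poly p (of_real t))) / real n = u n (z + t *\<^sub>R v)" for t
        by (simp add: p(4) u_def aff_line \<beta>_def)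
      define S where "S = {t \<in> {0..1}. z + t *\<^sub>R v \<in> K}"
      have "(\<integral>\<^sup>+t. ennreal ((ln (cmod (poly p (of_real t))) / real n)\<^sup>2) * indicator S t \<partial>lborel)
         \<le> ennreal C0"
        unfolding C0_def
      proof (rule \<Lambda>(2)[OF p(1) n(1)])
        show "- ln (cmod (lead_coeff p)) / real n \<le> A"
          using A1[of n] A2_0 unfolding p(3) A_def minus_divide_left[symmetric] by linarith
      qed (use p(2) up n(1) A1_0 A2_0 in \<open>auto simp: S_def pu A_def\<close>)
      moreover have "indicator K (z + t *\<^sub>R v) * indicator {0..1} t = (indicator S t :: ennreal)" for t
        by (auto simp: S_def indicator_def)
      ultimately show ?thesis
        using True by (simp add: pu mult.assoc)
    next
      case False
      have "indicator K (z + t *\<^sub>R v) * indicator {0..1} t = (0 :: ennreal)" for t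
      proof (rule ccontr)
        assume "\<not> ?thesis"
        then have t: "z + t *\<^sub>R v \<in> K" "0 \<le> t" "t \<le> 1" by (auto simp: indicator_def split: if_splits)
        have "norm z \<le> norm (z + t *\<^sub>R v) + norm (t *\<^sub>R v)"
          using norm_triangle_ineq4[of "z + t *\<^sub>R v" "t *\<^sub>R v"] by simp
        also have "\<dots> \<le> r + norm v"
          using r[OF t(1)] t by (intro add_mono) (auto intro: mult_left_le_one_le)
        finally show False using False by (simp add: B_def)
      qed
      then show ?thesis by (simp only: mult.assoc mult_zero_right mult_zero_left nn_integral_const zero_le)
    qed
    have "(\<integral>\<^sup>+z. ennreal ((u n z)\<^sup>2) * indicator K z \<partial>lborel)
       \<le> (\<integral>\<^sup>+z. ennreal C0 * indicator B z \<partial>lborel)"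
      by (subst nn_integral_lborel_average_line[where v = v]) (auto intro!: nn_integral_mono slice)
    also have "\<dots> = ennreal C0 * emeasure lborel B"
      by (simp add: nn_integral_cmult)
    also have "\<dots> = ennreal (C0 * measure lborel B)"
      using C0 Bfin by (simp add: ennreal_mult emeasure_eq_ennreal_measure)
    finally show "(\<integral>\<^sup>+z. ennreal ((ln (cmod (\<Sum>i<d. \<Prod>j\<in>{..<d} - {i}. (aff (a j) (b j) z) ^ n)) / real n)\<^sup>2)
       * indicator K z \<partial>lborel) \<le> ennreal (C0 * measure lborel B)"
      unfolding u_def .
  qed
qed

section \<open>Weak convergence of the currents\<close>

theorem theorem6p1:
  fixes d :: nat and a :: "nat \<Rightarrow> complex^'m" and b :: "nat \<Rightarrow> complex"
  assumes "d \<ge> 1"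
    and "\<And>i. i < d \<Longrightarrow> norm (a i) = 1"
    and "generic_arrangement d a b"
    and "\<And>i j. i < d \<Longrightarrow> j < d \<Longrightarrow>
           {z. aff (a i) (b i) z = 0} \<inter> {z. aff (a j) (b j) z = 0} \<noteq> {}"
  shows "ddc_converges
           (\<lambda>n z. ln (cmod (\<Sum>i<d. \<Prod>j\<in>{..<d} - {i}. (aff (a j) (b j) z) ^ n)) / real n)
           (\<lambda>z. (MAX i\<in>{..<d}. ln (1 / cmod (aff (a i) (b i) z)))
                + ln (cmod (\<Prod>i<d. aff (a i) (b i) z)))"
proof -
  have indep: "a j \<noteq> c *s a i" if ij: "i < d" "j < d" "i \<noteq> j" for i j c
  proof
    assume eq: "a j = c *s a i"
    have sub: "{i, j} \<subseteq> {..<d}" using ij by simp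
    \<comment> \<open>If \<open>m = 1\<close>, general position would make the two hyperplanes
      disjoint, although any two of them meet. So the pair has at most \<open>m\<close> elements and
      its normals are independent.\<close>
    have "\<not> card {i, j} > CARD('m)"
    proof
      assume "card {i, j} > CARD('m)"
      then have "(\<Inter>k\<in>{i, j}. {z. aff (a k) (b k) z = 0}) = {}"
        using assms(3) sub unfolding generic_arrangement_def by blast
      then show False using assms(4)[OF ij(1,2)] by simp
    qed
    then have "card {i, j} \<le> CARD('m)" by simp
    then have li: "(\<Sum>k\<in>{i, j}. e k *s a k) = 0 \<Longrightarrow> \<forall>k\<in>{i, j}. e k = 0" for e :: "nat \<Rightarrow> complex"
      using assms(3) sub unfolding generic_arrangement_def by blast
    show False
      using li[of "\<lambda>k. if k = i then c else -1"] ij(3) eq by simp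
  qed
  have sep: "\<exists>w. cmod (aff (a i) 0 w) \<noteq> cmod (aff (a j) 0 w)"
    if "i < d" "j < d" "i \<noteq> j" for i j
    using unit_vectors_separating_direction assms(2) indep that by blast
  have nonzero: "\<exists>w. aff (a i) 0 w \<noteq> 0" if i: "i < d" for i
  proof -
    obtain k where "a i $ k \<noteq> 0"
      using assms(2)[OF i] by (metis norm_zero vec_eq_iff zero_index zero_neq_one)
    moreover have "aff (a i) 0 (axis k 1) = a i $ k"
      by (simp add: aff_def axis_def if_distrib sum.delta cong: if_cong)
    ultimately show ?thesis by metis
  qed
  \<comment> \<open>The constant terms are a parameter: for the given \<open>b\<close> this is the
    exceptional set of the pointwise limit, and for \<open>b = 0\<close> any point outside it is an
    admissible direction \<open>v\<close>.\<close>
  define N where "N b = (\<Union>i<d. {z. aff (a i) (b i) z = 0}) \<union>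
      (\<Union>i<d. \<Union>j\<in>{..<d} - {i}. {z. cmod (aff (a i) (b i) z) = cmod (aff (a j) (b j) z)})"
    for b :: "nat \<Rightarrow> complex"
  have null: "N b \<in> null_sets lborel" for b
  proof -
    have "{z. aff (a i) (b i) z = 0} \<in> null_sets lborel" if "i < d" for i
      using nonzero[OF that] null_sets_aff_zero by blast
    moreover have "{z. cmod (aff (a i) (b i) z) = cmod (aff (a j) (b j) z)} \<in> null_sets lborel"
      if "i < d" "j \<in> {..<d} - {i}" for i j
      using sep[of i j] that null_sets_equal_modulus by blast
    ultimately show ?thesis
      unfolding N_def by (intro null_sets.Un null_sets_UN' countable_finite) auto
  qed
  obtain v where v: "v \<notin> N (\<lambda>_. 0)" using not_UNIV_if_null[OF null] by blast
  define u where "u n z = ln (cmod (\<Sum>i<d. \<Prod>j\<in>{..<d} - {i}. (aff (a j) (b j) z) ^ n)) / real n"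
    for n z
  define U where "U z = (MAX i\<in>{..<d}. ln (1 / cmod (aff (a i) (b i) z)))
                + ln (cmod (\<Prod>i<d. aff (a i) (b i) z))" for z
  have [measurable]: "u n \<in> borel_measurable borel" for n
    unfolding u_def by measurable
  have [measurable]: "U \<in> borel_measurable borel"
    unfolding U_def by measurable
  have lim: "AE z in lborel. (\<lambda>n. u n z) \<longlonglongrightarrow> U z"
    using AE_not_in[OF null[of b]]
  proof eventually_elim
    case (elim z)
    show ?case
      unfolding u_def U_def
      by (rule sum_cofactor_powers(2)[OF assms(1)]) (use elim in \<open>auto simp: N_def\<close>)
  qed
  have "ddc_converges u U"
    unfolding ddc_converges_def
  proof (intro allI impI)
    fix g :: "complex^'m \<Rightarrow> complex" and j k
    assume "test_fun g"
    define \<phi> where "\<phi> = wirt_dz (wirt_dzbar g k) j"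
    obtain K B where K: "compact K" "\<And>x. x \<notin> K \<Longrightarrow> \<phi> x = 0"
      and B: "\<And>x. cmod (\<phi> x) \<le> B" "B \<ge> 0" and [measurable]: "\<phi> \<in> borel_measurable borel"
      by (rule wirt_dz_wirt_dzbar_bounded_support[OF \<open>test_fun g\<close>, of k j, folded \<phi>_def])
        (rule that; assumption)
    have [measurable]: "K \<in> sets borel" using K by (simp add: compact_imp_closed)
    obtain C n0 where C: "C \<ge> 0"
      "\<And>n. n \<ge> n0 \<Longrightarrow> (\<integral>\<^sup>+z. ennreal ((u n z)\<^sup>2) * indicator K z \<partial>lborel) \<le> ennreal C"
      unfolding u_def
      by (rule cofactor_sum_L2_bound[OF assms(1) _ _ K(1), of a v b]) (use v in \<open>auto simp: N_def\<close>)
    \<comment> \<open>Restriction to \<open>K\<close> makes the measure finite and leaves the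
      pairings unchanged, since \<open>\<phi>\<close> vanishes off \<open>K\<close>.\<close>
    define M where "M = restrict_space lborel K"
    have fin: "finite_measure M"
      unfolding M_def using emeasure_compact_finite[OF K(1)]
      by (intro finite_measureI) (auto simp: emeasure_restrict_space space_restrict_space)
    have restr: "integral\<^sup>L M (\<lambda>x. of_real (h x) * \<phi> x) = integral\<^sup>L lborel (\<lambda>x. of_real (h x) * \<phi> x)"
      for h :: "complex^'m \<Rightarrow> real"
    proof -
      have "integral\<^sup>L M (\<lambda>x. of_real (h x) * \<phi> x)
          = integral\<^sup>L lborel (\<lambda>x. indicator K x *\<^sub>R (of_real (h x) * \<phi> x))"
        unfolding M_def by (rule integral_restrict_space) auto
      also have "\<dots> = integral\<^sup>L lborel (\<lambda>x. of_real (h x) * \<phi> x)"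
        by (intro Bochner_Integration.integral_cong) (auto simp: indicator_def K(2))
      finally show ?thesis .
    qed
    \<comment> \<open>The square-integral bound holds only from \<open>n0\<close> on, hence the
      shifted sequence; \<open>LIMSEQ_offset\<close> undoes the shift.\<close>
    have "(\<lambda>n. integral\<^sup>L M (\<lambda>x. of_real (u (n + n0) x) * \<phi> x))
        \<longlonglongrightarrow> integral\<^sup>L M (\<lambda>x. of_real (U x) * \<phi> x)"
    proof (rule integral_tendsto_if_L2_bounded[OF fin])
      show "AE x in M. (\<lambda>n. of_real (u (n + n0) x) * \<phi> x) \<longlonglongrightarrow> of_real (U x) * \<phi> x"
        unfolding M_def using lim
        by (subst AE_restrict_space_iff)
          (auto elim!: eventually_mono intro!: tendsto_intros LIMSEQ_ignore_initial_segment)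
      fix n
      have "(\<integral>\<^sup>+x. ennreal ((cmod (of_real (u (n + n0) x) * \<phi> x))\<^sup>2) \<partial>M)
          = (\<integral>\<^sup>+x. ennreal ((cmod (of_real (u (n + n0) x) * \<phi> x))\<^sup>2) * indicator K x \<partial>lborel)"
        unfolding M_def by (rule nn_integral_restrict_space) auto
      also have "\<dots> \<le> (\<integral>\<^sup>+x. ennreal (B\<^sup>2) * (ennreal ((u (n + n0) x)\<^sup>2) * indicator K x) \<partial>lborel)"
      proof (intro nn_integral_mono)
        fix x
        have "(cmod (of_real (u (n + n0) x) * \<phi> x))\<^sup>2 \<le> B\<^sup>2 * (u (n + n0) x)\<^sup>2"
          using power_mono[OF B(1)[of x] norm_ge_zero, of 2]
          by (simp add: norm_mult power_mult_distrib mult_right_mono mult.commute)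
        then show "ennreal ((cmod (of_real (u (n + n0) x) * \<phi> x))\<^sup>2) * indicator K x
            \<le> ennreal (B\<^sup>2) * (ennreal ((u (n + n0) x)\<^sup>2) * indicator K x)"
          by (auto simp: indicator_def ennreal_leI simp flip: ennreal_mult)
      qed
      also have "\<dots> \<le> ennreal (B\<^sup>2) * ennreal C"
        by (subst nn_integral_cmult) (auto intro!: mult_left_mono C)
      finally show "(\<integral>\<^sup>+x. ennreal ((cmod (of_real (u (n + n0) x) * \<phi> x))\<^sup>2) \<partial>M) \<le> ennreal (B\<^sup>2 * C)"
        using C(1) by (simp add: ennreal_mult)
    qed (auto simp: M_def intro!: measurable_restrict_space1)
    then show "(\<lambda>n. integral\<^sup>L lborel (\<lambda>x. complex_of_real (u n x) * wirt_dz (wirt_dzbar g k) j x))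
        \<longlonglongrightarrow> integral\<^sup>L lborel (\<lambda>x. complex_of_real (U x) * wirt_dz (wirt_dzbar g k) j x)"
      unfolding restr unfolding \<phi>_def by (rule LIMSEQ_offset)
  qed
  then show ?thesis unfolding u_def U_def .
qed

end
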